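(* For every odd prime $p$, the Laurent series $\Theta_p(t)$ associated to the $p$-Cantor sequence exhibits full generic escape of mass with respect to the sequence $\{t^k\}_{k\ge0}$; that is, for every $\varepsilon>0$, $\lim_{n\to\infty}d(\{k\in\mathbb{N}:e_{k,n}(\Theta_p(t))>1-\varepsilon\})=1$.
   Context: The $p$-Cantor sequence: for an odd prime $p$, $p_2=\frac{p-1}{2}$, identify $\{0,\dots,p-1\}$ with $\mathbb{F}_p$ and let $\phi_p(n)$ be the word of length $p$ whose $i$-th letter ($0\le i\le p-1$) is $n\binom{p_2}{i/2}\bmod p$ for even $i$ and $0$ for odd $i$; $\phi_p$ acts on words by concatenation. $(c^{(p)}_i)_{i\ge0}=\lim_n\phi_p^n(1)$ and $\Theta_p(t)=t^{-1}\sum_{i\ge0}c^{(p)}_it^{-i}$. For a quadratic irrational $\Theta$, $e_{k,n}(\Theta):=\frac{\sum_{i=1}^{\ell_{k}}\max\{\deg A_i^{[\Theta t^k]}-n,0\}}{\sum_{i=1}^{\ell_{k}}\deg A_i^{[\Theta t^k]}}$, where $\ell_k$ is the period length of the eventually periodic continued fraction expansion of $\Theta\cdot t^k$ and $A_1^{[\Theta t^k]},\dots,A_{\ell_k}^{[\Theta t^k]}$ are the partial quotients of one period. For $A\subseteq\mathbb{N}$, $d(A)=\lim_{m\to\infty}\frac{|A\cap\{1,\dots,m\}|}{m}$. *)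

theory Defs
  imports "HOL-Analysis.Analysis" "HOL-Computational_Algebra.Formal_Laurent_Series"
          "Berlekamp_Zassenhaus.Finite_Field"
begin

text \<open>Laurent series in t^{-1} over a field are modelled by 'a fls in the variable X = t^{-1}.
  Hence the coefficient of t^j is the coefficient of X^(-j), and a polynomial A in t
  of degree d corresponds to an fls with subdegree -d.\<close>

definition cantor_letter :: "nat \<Rightarrow> nat \<Rightarrow> nat \<Rightarrow> nat" where
  "cantor_letter p n i = (if even i then (n * ((p - 1) div 2 choose (i div 2))) mod p else 0)"

definition cantor_phi :: "nat \<Rightarrow> nat list \<Rightarrow> nat list" where
  "cantor_phi p w = concat (map (\<lambda>n. map (cantor_letter p n) [0..<p]) w)"

definition cantor_seq :: "nat \<Rightarrow> nat \<Rightarrow> nat" where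
  "cantor_seq p i = (THE a. \<forall>\<^sub>F n in sequentially.
       i < length ((cantor_phi p ^^ n) [1]) \<and> (cantor_phi p ^^ n) [1] ! i = a)"

definition Theta :: "'p::prime_card mod_ring fls" where
  "Theta = fls_X * fps_to_fls (Abs_fps (\<lambda>i. of_nat (cantor_seq CARD('p) i)))"

definition fls_frac :: "'a::field fls \<Rightarrow> 'a fls" where
  "fls_frac x = fls_X * fps_to_fls (fls_regpart (fls_X_inv * x))"

definition fls_ipart :: "'a::field fls \<Rightarrow> 'a fls" where
  "fls_ipart x = x - fls_frac x"

fun cf_rem :: "'a::field fls \<Rightarrow> nat \<Rightarrow> 'a fls" where
  "cf_rem x 0 = x"
| "cf_rem x (Suc i) = inverse (fls_frac (cf_rem x i))"

definition cf_pq :: "'a::field fls \<Rightarrow> nat \<Rightarrow> 'a fls" where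
  "cf_pq x i = fls_ipart (cf_rem x i)"

definition tdeg :: "'a::field fls \<Rightarrow> nat" where
  "tdeg A = nat (- fls_subdegree A)"

definition cf_period :: "'a::field fls \<Rightarrow> nat" where
  "cf_period x = (LEAST l. l > 0 \<and> (\<exists>N. \<forall>i\<ge>N. cf_pq x (i + l) = cf_pq x i))"

definition cf_preperiod :: "'a::field fls \<Rightarrow> nat" where
  "cf_preperiod x = (LEAST N. \<forall>i\<ge>N. cf_pq x (i + cf_period x) = cf_pq x i)"

definition escape :: "'a::field fls \<Rightarrow> nat \<Rightarrow> nat \<Rightarrow> real" where
  "escape Th k n =
     (let x = Th * fls_X_inv ^ k; N = cf_preperiod x; I = {N..<N + cf_period x} in
      (\<Sum>i\<in>I. real (tdeg (cf_pq x i) - n)) / (\<Sum>i\<in>I. real (tdeg (cf_pq x i))))"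

definition nat_density :: "nat set \<Rightarrow> real" where
  "nat_density A = lim (\<lambda>m. real (card (A \<inter> {1..m})) / real m)"

end

theory Submission
  imports Defs
begin

text \<open>Since \<open>\<Theta> = 1 / \<surd>(1 + t\<^sup>2)\<close>, Frobenius gives, for \<open>N = p\<^sup>s = 2 m + 1\<close> and \<open>k = N a + r\<close> with
  \<open>a\<close> odd and \<open>0 \<le> r < N\<close>, that \<open>\<Theta> t\<^sup>k = t\<^sup>r (1 + t\<^sup>2)\<^sup>m W\<close> with a series \<open>W\<close> in \<open>t\<^sup>2\<^sup>N\<close>. Dirichlet
  approximation of \<open>W\<close> and of \<open>(1 + t\<^sup>2)\<^sup>N W\<close> by polynomials in \<open>t\<^sup>2\<^sup>N\<close> yields approximations of
  \<open>\<Theta> t\<^sup>k\<close> so good that the degrees of the denominators of its convergents lie in at most \<open>r + 2\<close>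
  residue classes modulo \<open>N\<close>. Hence a period of total degree \<open>S\<close> has at most \<open>(r + 2) S / N\<close> partial
  quotients, and \<open>e\<^sub>k\<^sub>,\<^sub>n \<ge> 1 - n (r + 2) / N\<close>. For every \<open>\<delta> > 0\<close>, almost every \<open>k\<close> admits some \<open>N\<close> with
  \<open>(r + 2) / N < \<delta>\<close>, so the density is already \<open>1\<close> for each fixed \<open>n\<close>.\<close>

unbundle no vec_syntax
unbundle Formal_Power_Series.fps_syntax and Formal_Laurent_Series.fps_syntax

subsection \<open>Laurent series in the inverse of \<open>t\<close>\<close>

definition is_tpoly :: "'a::field fls \<Rightarrow> bool" where
  "is_tpoly f \<longleftrightarrow> (\<forall>n>0. f $$ n = 0)"

text \<open>With \<open>X\<close> = 1/t this bounds the degree in t by \<open>- m\<close>. Unlike a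
  condition on \<open>fls_subdegree\<close>, it treats the zero series uniformly.\<close>

definition val_ge :: "'a::field fls \<Rightarrow> int \<Rightarrow> bool" where
  "val_ge f m \<longleftrightarrow> (\<forall>n<m. f $$ n = 0)"

definition supp_dvd :: "nat \<Rightarrow> 'a::field fls \<Rightarrow> bool" where
  "supp_dvd h f \<longleftrightarrow> (\<forall>n. f $$ n \<noteq> 0 \<longrightarrow> int h dvd n)"

lemma fls_times_nth_eq_0:
  fixes f g :: "'a::field fls"
  assumes "\<And>i. f $$ i = 0 \<or> g $$ (n - i) = 0"
  shows "(f * g) $$ n = 0"
  unfolding fls_times_nth(2) using assms by (intro sum.neutral) auto

lemma is_tpoly_0 [simp]: "is_tpoly 0" and is_tpoly_1 [simp]: "is_tpoly 1"
  and is_tpoly_X_inv [simp]: "is_tpoly fls_X_inv"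
  by (auto simp: is_tpoly_def)

lemma is_tpoly_uminus [simp]: "is_tpoly f \<Longrightarrow> is_tpoly (- f)"
  and is_tpoly_add [simp]: "is_tpoly f \<Longrightarrow> is_tpoly g \<Longrightarrow> is_tpoly (f + g)"
  and is_tpoly_diff [simp]: "is_tpoly f \<Longrightarrow> is_tpoly g \<Longrightarrow> is_tpoly (f - g)"
  by (auto simp: is_tpoly_def)

lemma is_tpoly_mult [simp]:
  assumes "is_tpoly f" "is_tpoly g"
  shows "is_tpoly (f * g)"
proof -
  have "f $$ i = 0 \<or> g $$ (n - i) = 0" if "n > 0" for n i
    using assms that by (cases "i > 0") (auto simp: is_tpoly_def)
  thus ?thesis by (auto simp: is_tpoly_def intro: fls_times_nth_eq_0)
qed

lemma is_tpoly_power [simp]: "is_tpoly f \<Longrightarrow> is_tpoly (f ^ n)"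
  by (induction n) auto

lemma is_tpoly_sum: "(\<And>i. i \<in> A \<Longrightarrow> is_tpoly (f i)) \<Longrightarrow> is_tpoly (sum f A)"
  by (induction A rule: infinite_finite_induct) auto

lemma val_ge_0 [simp]: "val_ge 0 m"
  by (auto simp: val_ge_def)

lemma val_ge_mono: "val_ge f m \<Longrightarrow> l \<le> m \<Longrightarrow> val_ge f l"
  by (auto simp: val_ge_def)

lemma val_ge_uminus: "val_ge f m \<Longrightarrow> val_ge (- f) m"
  and val_ge_add: "val_ge f m \<Longrightarrow> val_ge g m \<Longrightarrow> val_ge (f + g) m"
  and val_ge_diff: "val_ge f m \<Longrightarrow> val_ge g m \<Longrightarrow> val_ge (f - g) m"
  by (auto simp: val_ge_def)

lemma val_ge_mult:
  assumes "val_ge f m" "val_ge g l"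
  shows "val_ge (f * g) (m + l)"
proof -
  have "f $$ i = 0 \<or> g $$ (n - i) = 0" if "n < m + l" for n i
    using assms that by (cases "i < m") (auto simp: val_ge_def)
  thus ?thesis by (auto simp: val_ge_def intro: fls_times_nth_eq_0)
qed

lemma val_ge_power: "val_ge f m \<Longrightarrow> val_ge (f ^ n) (int n * m)"
proof (induction n)
  case (Suc n)
  thus ?case using val_ge_mult[of f m "f ^ n" "int n * m"] by (simp add: algebra_simps)
qed (auto simp: val_ge_def)

lemma val_ge_sum: "(\<And>i. i \<in> A \<Longrightarrow> val_ge (f i) m) \<Longrightarrow> val_ge (sum f A) m"
  by (induction A rule: infinite_finite_induct) (auto intro: val_ge_add)

lemma val_ge_iff_subdegree: "f \<noteq> 0 \<Longrightarrow> val_ge f m \<longleftrightarrow> m \<le> fls_subdegree f"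
  using nth_fls_subdegree_nonzero[of f] unfolding val_ge_def
  by (meson fls_eq0_below_subdegree linorder_not_less order_less_le_trans)

lemma val_ge_subdegree: "val_ge f (fls_subdegree f)"
  by (auto simp: val_ge_def)

text \<open>The analogue of the fact that an integer of absolute value below 1 is 0; it turns good
  approximations into identities.\<close>

lemma is_tpoly_val_ge_pos_eq_0:
  assumes "is_tpoly f" "val_ge f m" "m > 0"
  shows "f = 0"
proof (rule fls_zero_eqI)
  fix n show "f $$ n = 0"
    using assms by (cases "n > 0") (auto simp: is_tpoly_def val_ge_def)
qed

lemma supp_dvd_mult:
  assumes "supp_dvd h f" "supp_dvd h g"
  shows "supp_dvd h (f * g)"
  unfolding supp_dvd_def
proof (intro allI impI)
  fix n assume "(f * g) $$ n \<noteq> 0"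
  then obtain i where i: "f $$ i \<noteq> 0" "g $$ (n - i) \<noteq> 0"
    using fls_times_nth_eq_0 by metis
  hence "int h dvd i + (n - i)"
    using assms by (intro dvd_add) (auto simp: supp_dvd_def)
  thus "int h dvd n" by simp
qed

lemma supp_dvd_1 [simp]: "supp_dvd h 1"
  by (auto simp: supp_dvd_def)

lemma supp_dvd_add: "supp_dvd h f \<Longrightarrow> supp_dvd h g \<Longrightarrow> supp_dvd h (f + g)"
  unfolding supp_dvd_def by (metis add_0 fls_plus_nth)

lemma supp_dvd_X_inv_power: "h dvd n \<Longrightarrow> supp_dvd h (fls_X_inv ^ n)"
  by (auto simp: supp_dvd_def)

lemma fls_frac_nth: "fls_frac x $$ n = (if n > 0 then x $$ n else 0)"
proof -
  have "fls_frac x $$ n = fps_to_fls (fls_regpart (fls_X_inv * x)) $$ (n - 1)"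
    unfolding fls_frac_def by (simp add: fls_X_times_conv_shift)
  thus ?thesis by (auto simp: fls_X_inv_times_conv_shift)
qed

lemma fls_ipart_nth: "fls_ipart x $$ n = (if n > 0 then 0 else x $$ n)"
  by (simp add: fls_ipart_def fls_frac_nth)

lemma is_tpoly_ipart [simp]: "is_tpoly (fls_ipart x)"
  by (simp add: is_tpoly_def fls_ipart_nth)

lemma ipart_plus_frac: "fls_ipart x + fls_frac x = x"
  by (simp add: fls_ipart_def)

lemma val_ge_frac: "val_ge (fls_frac x) 1"
  by (auto simp: val_ge_def fls_frac_nth)

lemma subdegree_ipart:
  assumes "x \<noteq> 0" "fls_subdegree x \<le> 0"
  shows "fls_subdegree (fls_ipart x) = fls_subdegree x"
  using assms by (intro fls_subdegree_eqI) (auto simp: fls_ipart_nth)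

subsection \<open>Continued fractions\<close>

fun cf_num :: "'a::field fls \<Rightarrow> nat \<Rightarrow> 'a fls" where
  "cf_num x 0 = 1"
| "cf_num x (Suc 0) = cf_pq x 0"
| "cf_num x (Suc (Suc i)) = cf_pq x (Suc i) * cf_num x (Suc i) + cf_num x i"

text \<open>Indices are shifted by one against the usual convention: \<open>cf_den x (Suc i)\<close> is the
  denominator of the convergent \<open>[a\<^sub>0; a\<^sub>1, \<dots>, a\<^sub>i]\<close>.\<close>
fun cf_den :: "'a::field fls \<Rightarrow> nat \<Rightarrow> 'a fls" where
  "cf_den x 0 = 0"
| "cf_den x (Suc 0) = 1"
| "cf_den x (Suc (Suc i)) = cf_pq x (Suc i) * cf_den x (Suc i) + cf_den x i"

definition cf_err :: "'a::field fls \<Rightarrow> nat \<Rightarrow> 'a fls" where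
  "cf_err x i = cf_den x i * x - cf_num x i"

text \<open>For irrational \<open>x\<close> this is the degree of \<open>cf_den x (Suc i)\<close>;
  the polynomial part \<open>cf_pq x 0\<close> does not enter the denominators.\<close>

definition den_deg :: "'a::field fls \<Rightarrow> nat \<Rightarrow> nat" where
  "den_deg x i = (\<Sum>j\<in>{1..i}. tdeg (cf_pq x j))"

definition irrational_fls :: "'a::field fls \<Rightarrow> bool" where
  "irrational_fls x \<longleftrightarrow> (\<forall>Q. is_tpoly Q \<and> is_tpoly (Q * x) \<longrightarrow> Q = 0)"

lemma is_tpoly_pq [simp]: "is_tpoly (cf_pq x i)"
  by (simp add: cf_pq_def)

lemma is_tpoly_num [simp]: "is_tpoly (cf_num x i)"
  by (induction x i rule: cf_num.induct) auto

lemma is_tpoly_den [simp]: "is_tpoly (cf_den x i)"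
  by (induction x i rule: cf_den.induct) auto

lemma irrational_frac_nonzero:
  assumes "irrational_fls x"
  shows "fls_frac x \<noteq> 0"
proof
  assume "fls_frac x = 0"
  hence "x = fls_ipart x" using ipart_plus_frac[of x] by simp
  hence "is_tpoly (1 * x)" by (metis mult_1 is_tpoly_ipart)
  thus False using assms is_tpoly_1 unfolding irrational_fls_def by (metis one_neq_zero)
qed

text \<open>If \<open>R = Q / fls_frac x\<close> is a polynomial, so is
  \<open>R * x = Q + R * fls_ipart x\<close>; hence \<open>R\<close> is a denominator of
  \<open>x\<close> and vanishes.\<close>

lemma irrational_inverse_frac:
  assumes "irrational_fls x"
  shows "irrational_fls (inverse (fls_frac x))"
  unfolding irrational_fls_def
proof (intro allI impI, elim conjE)
  fix Q assume Q: "is_tpoly Q" "is_tpoly (Q * inverse (fls_frac x))"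
  define R where "R = Q * inverse (fls_frac x)"
  have "R * fls_frac x = Q"
    using irrational_frac_nonzero[OF assms] by (simp add: R_def)
  hence "R * x = Q + R * fls_ipart x"
    by (subst ipart_plus_frac[of x, symmetric]) (simp add: algebra_simps)
  hence "is_tpoly (R * x)" using Q by (simp add: R_def)
  hence "R = 0" using assms Q unfolding irrational_fls_def R_def by blast
  thus "Q = 0" using irrational_frac_nonzero[OF assms] by (simp add: R_def)
qed

locale irrational =
  fixes x :: "'a::field fls"
  assumes irr: "irrational_fls x"
begin

lemma rem_irrational: "irrational_fls (cf_rem x i)"
  by (induction i) (auto intro: irr irrational_inverse_frac)

lemma frac_rem_nonzero: "fls_frac (cf_rem x i) \<noteq> 0"
  by (rule irrational_frac_nonzero[OF rem_irrational])

lemma rem_nonzero: "cf_rem x (Suc i) \<noteq> 0"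
  using frac_rem_nonzero[of i] by simp

lemma subdegree_rem: "fls_subdegree (cf_rem x (Suc i)) < 0"
proof -
  have "1 \<le> fls_subdegree (fls_frac (cf_rem x i))"
    using val_ge_frac frac_rem_nonzero val_ge_iff_subdegree by blast
  thus ?thesis by simp
qed

lemma subdegree_pq:
  "fls_subdegree (cf_pq x (Suc i)) = fls_subdegree (cf_rem x (Suc i))"
  unfolding cf_pq_def using subdegree_rem[of i] rem_nonzero[of i]
  by (intro subdegree_ipart) auto

lemma tdeg_pq_pos: "tdeg (cf_pq x (Suc i)) > 0"
  using subdegree_rem[of i] unfolding tdeg_def subdegree_pq by simp

lemma int_tdeg_pq: "int (tdeg (cf_pq x (Suc i))) = - fls_subdegree (cf_pq x (Suc i))"
  using subdegree_rem[of i] unfolding tdeg_def subdegree_pq by simp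

lemma den_deg_0 [simp]: "den_deg x 0 = 0"
  and den_deg_Suc: "den_deg x (Suc i) = den_deg x i + tdeg (cf_pq x (Suc i))"
  by (simp_all add: den_deg_def)

lemma strict_mono_den_deg: "strict_mono (den_deg x)"
  by (auto simp: strict_mono_Suc_iff den_deg_Suc tdeg_pq_pos)

text \<open>The classical formula for complete quotients as negated ratios of consecutive
  errors.\<close>

lemma err_Suc: "cf_err x (Suc i) * cf_rem x (Suc i) = - cf_err x i"
proof (induction i)
  case 0
  have "cf_err x (Suc 0) = fls_frac x"
    using ipart_plus_frac[of x] by (simp add: cf_err_def cf_pq_def algebra_simps)
  thus ?case using frac_rem_nonzero[of 0] by (simp add: cf_err_def)
next
  case (Suc i)
  have "cf_err x (Suc (Suc i)) = cf_pq x (Suc i) * cf_err x (Suc i) + cf_err x i"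
    by (simp add: cf_err_def algebra_simps)
  also have "cf_err x i = - (cf_err x (Suc i) * cf_rem x (Suc i))"
    using Suc by simp
  also have "cf_rem x (Suc i) = cf_pq x (Suc i) + fls_frac (cf_rem x (Suc i))"
    by (metis cf_pq_def ipart_plus_frac)
  finally have "cf_err x (Suc (Suc i)) = - (cf_err x (Suc i) * fls_frac (cf_rem x (Suc i)))"
    by (simp add: algebra_simps)
  thus ?case using frac_rem_nonzero[of "Suc i"] by simp
qed

lemma err_nonzero: "cf_err x i \<noteq> 0"
proof (induction i)
  case 0 thus ?case by (simp add: cf_err_def)
next
  case (Suc i) thus ?case using err_Suc[of i] by auto
qed

text \<open>By \<open>err_Suc\<close>, each step divides the error, up to sign, by a remainder whose
  degree is that of the next partial quotient.\<close>

lemma subdegree_err: "fls_subdegree (cf_err x i) = int (den_deg x i)"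
proof (induction i)
  case 0 thus ?case by (simp add: cf_err_def)
next
  case (Suc i)
  have "fls_subdegree (cf_err x (Suc i)) + fls_subdegree (cf_rem x (Suc i))
      = fls_subdegree (cf_err x (Suc i) * cf_rem x (Suc i))"
    by (rule fls_subdegree_mult[symmetric]) (use err_nonzero rem_nonzero in auto)
  also have "\<dots> = int (den_deg x i)"
    unfolding err_Suc using Suc by simp
  finally show ?case
    using int_tdeg_pq[of i] subdegree_pq[of i] by (simp add: den_deg_Suc)
qed

lemma val_ge_err: "val_ge (cf_err x i) (int (den_deg x i))"
  using val_ge_subdegree[of "cf_err x i"] by (simp add: subdegree_err)

lemma val_ge_den: "val_ge (cf_den x (Suc i)) (- int (den_deg x i))"
proof (induction i rule: less_induct)
  case (less i)
  show ?case
  proof (cases i)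
    case 0 thus ?thesis by (auto simp: val_ge_def)
  next
    case (Suc j)
    have pq: "val_ge (cf_pq x (Suc j)) (- int (tdeg (cf_pq x (Suc j))))"
      using val_ge_subdegree[of "cf_pq x (Suc j)"] by (simp add: int_tdeg_pq)
    have 1: "val_ge (cf_pq x (Suc j) * cf_den x (Suc j)) (- int (den_deg x i))"
      using val_ge_mult[OF pq less[of j]] Suc by (simp add: den_deg_Suc algebra_simps)
    have 2: "val_ge (cf_den x j) (- int (den_deg x i))"
    proof (cases j)
      case (Suc k)
      thus ?thesis using less[of k] \<open>i = Suc j\<close>
        by (auto simp: den_deg_Suc elim: val_ge_mono)
    qed auto
    show ?thesis using val_ge_add[OF 1 2] Suc by simp
  qed
qed

lemma cf_det:
  "cf_den x (Suc i) * cf_num x i - cf_den x i * cf_num x (Suc i) = (-1) ^ i"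
  by (induction i) (simp_all add: algebra_simps)

text \<open>If \<open>Q\<close> approximates too well, then both \<open>Q P' - P Q'\<close> vanish for two consecutive
  convergents \<open>P'/Q'\<close>, and the determinant identity forces \<open>Q = 0\<close>.\<close>
lemma den_deg_neq:
  assumes "is_tpoly Q" "is_tpoly P" "Q \<noteq> 0"
  assumes "val_ge Q (1 - int D)" "val_ge (Q * x - P) (int D + 1)"
  shows "den_deg x i \<noteq> D"
proof
  assume D: "den_deg x i = D"
  have *: "Q * cf_num x l = P * cf_den x l"
    if l: "val_ge (cf_err x l) (int D)" "val_ge (cf_den x l) (- int D)" for l
  proof -
    \<comment> \<open>The terms in \<open>x\<close> cancel. In both products the valuation bounds
      add up to 1: \<open>- D + (D + 1)\<close> and \<open>(1 - D) + D\<close>.\<close>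
    have eq: "Q * cf_num x l - P * cf_den x l = cf_den x l * (Q * x - P) - Q * cf_err x l"
      by (simp add: cf_err_def algebra_simps)
    have "val_ge (cf_den x l * (Q * x - P)) 1" "val_ge (Q * cf_err x l) 1"
      using val_ge_mult[OF l(2) assms(5)] val_ge_mult[OF assms(4) l(1)] by simp_all
    hence "val_ge (Q * cf_num x l - P * cf_den x l) 1"
      unfolding eq by (rule val_ge_diff)
    moreover have "is_tpoly (Q * cf_num x l - P * cf_den x l)"
      using assms by simp
    ultimately show ?thesis using is_tpoly_val_ge_pos_eq_0 by force
  qed
  \<comment> \<open>At index \<open>i\<close> the error has valuation \<open>D\<close> and the
    denominator has degree below \<open>D\<close>; at \<open>Suc i\<close> the error is smaller
    still and the degree is at most \<open>D\<close>.\<close>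
  have 1: "Q * cf_num x i = P * cf_den x i"
  proof (rule *)
    show "val_ge (cf_err x i) (int D)" using val_ge_err[of i] D by simp
    show "val_ge (cf_den x i) (- int D)"
    proof (cases i)
      case (Suc j)
      thus ?thesis using val_ge_den[of j] D den_deg_Suc[of j]
        by (auto elim: val_ge_mono)
    qed auto
  qed
  have 2: "Q * cf_num x (Suc i) = P * cf_den x (Suc i)"
  proof (rule *)
    show "val_ge (cf_err x (Suc i)) (int D)"
      using val_ge_err[of "Suc i"] D den_deg_Suc[of i] by (auto elim: val_ge_mono)
    show "val_ge (cf_den x (Suc i)) (- int D)"
      using val_ge_den[of i] D by simp
  qed
  have "Q * (-1) ^ i = cf_den x (Suc i) * (Q * cf_num x i) - cf_den x i * (Q * cf_num x (Suc i))"
    unfolding cf_det[symmetric] by (simp add: algebra_simps)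
  also have "\<dots> = 0" unfolding 1 2 by (simp add: algebra_simps)
  finally show False using assms by simp
qed

end

section \<open>Eventual periodicity for square roots over a finite field\<close>

lemma finite_bounded_is_tpoly:
  "finite {f :: 'a::{field,finite} fls. is_tpoly f \<and> val_ge f (- int m)}" (is "finite ?S")
proof (rule inj_on_finite)
  let ?c = "\<lambda>f :: 'a fls. restrict (\<lambda>i. f $$ (- int i)) {..m}"
  show "inj_on ?c ?S"
  proof (intro inj_onI fls_eqI)
    fix f g :: "'a fls" and n
    assume f: "f \<in> ?S" and g: "g \<in> ?S" and eq: "?c f = ?c g"
    have "f $$ (- int i) = g $$ (- int i)" if "i \<le> m" for i
      using fun_cong[OF eq, of i] that by simp
    from this[of "nat (- n)"] show "f $$ n = g $$ n"
      using f g by (cases "n > 0"; cases "n < - int m") (auto simp: is_tpoly_def val_ge_def)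
  qed
  show "?c ` ?S \<subseteq> {..m} \<rightarrow>\<^sub>E UNIV" by (auto split: if_splits)
  show "finite ({..m} \<rightarrow>\<^sub>E (UNIV :: 'a set))" by (intro finite_PiE) auto
qed

text \<open>The square of \<open>x\<close> is a rational function with denominator \<open>E\<close>,
  so conjugation sends \<open>x\<close> to \<open>- x\<close>. Every \<open>Theta\<close> times t^k
  has this shape.\<close>

locale quadratic_irrational = irrational x for x :: "'a::{field,finite} fls" +
  fixes E :: "'a fls"
  assumes E: "is_tpoly E" "E \<noteq> 0" "is_tpoly (E * x\<^sup>2)"
begin

lemma den_nonzero: "cf_den x (Suc i) \<noteq> 0"
proof
  assume "cf_den x (Suc i) = 0"
  hence "is_tpoly (cf_err x (Suc i))" by (simp add: cf_err_def)
  moreover have "int (den_deg x (Suc i)) > 0"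
    using tdeg_pq_pos[of i] by (simp add: den_deg_Suc)
  ultimately show False
    using is_tpoly_val_ge_pos_eq_0[OF _ val_ge_err, of "Suc i"] err_nonzero by blast
qed

text \<open>With \<open>\<xi>\<^sub>i = cf_err x i\<close> and its conjugate \<open>- (cf_den x i * x + cf_num x i)\<close>, the remainder
  \<open>- \<xi>\<^sub>i / \<xi>\<^sub>i\<^sub>+\<^sub>1\<close> is made rational in the denominator; both resulting polynomials have bounded degree.\<close>
lemma finite_remainders: "finite (range (\<lambda>i. cf_rem x (Suc i)))"
proof -
  define d where "d = nat (- fls_subdegree x)"
  define e where "e = nat (- fls_subdegree E)"
  define S where "S = {f :: 'a fls. is_tpoly f \<and> val_ge f (- int (d + e))}"
  have x: "val_ge x (- int d)" and Ev: "val_ge E (- int e)"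
    using val_ge_subdegree[of x] val_ge_subdegree[of E] by (auto simp: d_def e_def elim: val_ge_mono)
  have "cf_rem x (Suc i) \<in> (\<lambda>(s, B, A). - (B - s * (E * x)) / A) ` ({1, -1} \<times> S \<times> S)" for i
  proof -
    define \<eta> where "\<eta> = cf_den x (Suc i) * x + cf_num x (Suc i)"
    define s :: "'a fls" where "s = (-1) ^ i"
    define A where "A = E * (cf_err x (Suc i) * \<eta>)"
    \<comment> \<open>By \<open>cf_det\<close>, the part of \<open>cf_err x i * \<eta>\<close>
      linear in \<open>x\<close> has coefficient \<open>- s\<close>; the added term cancels
      it.\<close>
    define B where "B = E * (cf_err x i * \<eta>) + s * (E * x)"
    \<comment> \<open>Up to a small error \<open>\<eta>\<close> is twice
      \<open>cf_den x (Suc i) * x\<close>, which bounds its degree.\<close>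
    have \<eta>_eq: "\<eta> = cf_den x (Suc i) * x + cf_den x (Suc i) * x - cf_err x (Suc i)"
      by (simp add: \<eta>_def cf_err_def)
    have den_x: "val_ge (cf_den x (Suc i) * x) (- int (den_deg x i) - int d)"
      using val_ge_mult[OF val_ge_den x, of i] by simp
    have "val_ge \<eta> (- int (den_deg x i) - int d)"
      unfolding \<eta>_eq by (intro val_ge_add val_ge_diff den_x val_ge_mono[OF val_ge_err]) auto
    moreover have le: "den_deg x i \<le> den_deg x (Suc i)"
      by (simp add: den_deg_Suc)
    ultimately have "val_ge (cf_err x i * \<eta>) (int (den_deg x i) + (- int (den_deg x i) - int d))"
      "val_ge (cf_err x (Suc i) * \<eta>) (int (den_deg x (Suc i)) + (- int (den_deg x i) - int d))"
      using val_ge_mult[OF val_ge_err[of i]] val_ge_mult[OF val_ge_err[of "Suc i"]] by blast+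
    hence v: "val_ge (cf_err x i * \<eta>) (- int d)" "val_ge (cf_err x (Suc i) * \<eta>) (- int d)"
      using le by (auto intro: val_ge_mono)
    have "val_ge A (- int (d + e))" "val_ge (E * (cf_err x i * \<eta>)) (- int (d + e))"
      unfolding A_def using val_ge_mult[OF Ev v(1)] val_ge_mult[OF Ev v(2)] by (simp_all add: algebra_simps)
    moreover have "val_ge (E * x) (- int (d + e))"
      using val_ge_mult[OF Ev x] by (simp add: algebra_simps)
    hence "val_ge (s * (E * x)) (- int (d + e))"
      by (cases "even i") (auto simp: s_def intro: val_ge_uminus)
    ultimately have bounds: "val_ge A (- int (d + e))" "val_ge B (- int (d + e))"
      unfolding B_def by (auto intro: val_ge_add)
    have "A = cf_den x (Suc i) ^ 2 * (E * x\<^sup>2) - E * cf_num x (Suc i) ^ 2"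
      by (simp add: A_def \<eta>_def cf_err_def power2_eq_square algebra_simps)
    hence A_poly: "is_tpoly A" using E by simp
    have "B = cf_den x i * cf_den x (Suc i) * (E * x\<^sup>2) - E * (cf_num x i * cf_num x (Suc i))"
      unfolding B_def s_def cf_det[symmetric]
      by (simp add: \<eta>_def cf_err_def power2_eq_square algebra_simps)
    hence B_poly: "is_tpoly B" using E by simp
    have "\<eta> \<noteq> 0"
    proof
      assume "\<eta> = 0"
      hence "cf_den x (Suc i) * x = - cf_num x (Suc i)"
        by (simp add: \<eta>_def eq_neg_iff_add_eq_0)
      hence "is_tpoly (cf_den x (Suc i) * x)" by simp
      thus False using irr den_nonzero[of i] is_tpoly_den unfolding irrational_fls_def by blast
    qed
    hence "cf_rem x (Suc i) = - (B - s * (E * x)) / A"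
      using err_Suc[of i] err_nonzero[of "Suc i"] E(2)
      by (simp add: A_def B_def field_simps)
    moreover have "s \<in> {1, -1}" by (cases "even i") (auto simp: s_def)
    ultimately show ?thesis using A_poly B_poly bounds unfolding S_def by force
  qed
  moreover have "finite ({1, -1 :: 'a fls} \<times> S \<times> S)"
    unfolding S_def using finite_bounded_is_tpoly by blast
  ultimately show ?thesis by (meson finite_imageI finite_subset image_subsetI)
qed

text \<open>Lagrange's theorem by pigeonhole: two remainders coincide, and a remainder determines
  all later ones.\<close>

lemma eventually_periodic: "\<exists>l>0. \<exists>N. \<forall>i\<ge>N. cf_pq x (i + l) = cf_pq x i"
proof -
  have "\<not> inj (\<lambda>i. cf_rem x (Suc i))"
    using finite_remainders finite_imageD[of "\<lambda>i. cf_rem x (Suc i)" UNIV] by auto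
  then obtain i j where "i < j" "cf_rem x (Suc i) = cf_rem x (Suc j)"
    unfolding inj_def by (metis linorder_neqE_nat)
  hence "j - i > 0" "cf_rem x (Suc i + (j - i)) = cf_rem x (Suc i)" by auto
  then obtain i l where il: "l > 0" "cf_rem x (Suc i + l) = cf_rem x (Suc i)"
    using that by blast
  have "cf_rem x (Suc i + l + n) = cf_rem x (Suc i + n)" for n
    using il by (induction n) auto
  hence "cf_pq x (n + l) = cf_pq x n" if "n \<ge> Suc i" for n
    using that by (auto simp: cf_pq_def le_iff_add algebra_simps)
  thus ?thesis using il by blast
qed

text \<open>Eventual periodicity makes both \<open>LEAST\<close> operators meaningful.\<close>

lemma period_props:
  "cf_period x > 0" "i \<ge> cf_preperiod x \<Longrightarrow> cf_pq x (i + cf_period x) = cf_pq x i"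
proof -
  have *: "cf_period x > 0 \<and> (\<exists>N. \<forall>i\<ge>N. cf_pq x (i + cf_period x) = cf_pq x i)"
    unfolding cf_period_def by (rule LeastI_ex) (use eventually_periodic in auto)
  thus "cf_period x > 0" by simp
  have "\<forall>i\<ge>cf_preperiod x. cf_pq x (i + cf_period x) = cf_pq x i"
    unfolding cf_preperiod_def by (rule LeastI_ex) (use * in auto)
  thus "i \<ge> cf_preperiod x \<Longrightarrow> cf_pq x (i + cf_period x) = cf_pq x i" by blast
qed

lemma den_deg_add: "den_deg x (i + n) = den_deg x i + (\<Sum>j<n. tdeg (cf_pq x (Suc (i + j))))"
  by (induction n) (simp_all add: den_deg_Suc)

lemma den_deg_period:
  assumes "i \<ge> cf_preperiod x"
  shows "den_deg x (i + cf_period x) = den_deg x i +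
    (\<Sum>j\<in>{cf_preperiod x..<cf_preperiod x + cf_period x}. tdeg (cf_pq x j))"
  using assms
proof (induction i rule: dec_induct)
  case base
  let ?M = "cf_preperiod x" and ?l = "cf_period x"
  have "(\<Sum>j\<in>{?M..<?M + ?l}. tdeg (cf_pq x j)) = (\<Sum>j<?l. tdeg (cf_pq x (?M + j)))"
    using sum.shift_bounds_nat_ivl[of "\<lambda>j. tdeg (cf_pq x j)" 0 ?M ?l]
    by (simp add: add.commute atLeast0LessThan)
  \<comment> \<open>\<open>den_deg\<close> adds the window \<open>?M + 1\<close> to
    \<open>?M + ?l\<close>, one place later than the chosen period; the two end terms agree by
    periodicity.\<close>
  moreover have "(\<Sum>j<?l. tdeg (cf_pq x (?M + j))) + tdeg (cf_pq x (?M + ?l))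
      = tdeg (cf_pq x ?M) + (\<Sum>j<?l. tdeg (cf_pq x (Suc (?M + j))))"
    using sum.lessThan_Suc_shift[of "\<lambda>j. tdeg (cf_pq x (?M + j))" ?l] by simp
  ultimately show ?case using period_props(2)[of ?M] by (simp add: den_deg_add)
next
  case (step i)
  thus ?case using period_props(2)[of "Suc i"] by (simp add: den_deg_Suc)
qed

end

section \<open>Counting degrees in few residue classes\<close>

lemma card_residues_interval_le:
  fixes a N S :: nat
  assumes "finite R" "N > 0"
  shows "card {D \<in> {a..<a + S * N}. D mod N \<in> R} \<le> S * card R"
proof -
  \<comment> \<open>A number is determined by its residue and its block of length \<open>N\<close>
    counted from \<open>a\<close>; there are \<open>S\<close> blocks.\<close>
  let ?f = "\<lambda>D. ((D - a) div N, D mod N)"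
  have "inj_on ?f {a..}"
  proof (intro inj_onI)
    fix D D' assume *: "D \<in> {a..}" "D' \<in> {a..}" "?f D = ?f D'"
    have "(D - a) mod N = (D' - a) mod N"
      using * cong_add_lcancel_nat[of a "D - a" "D' - a" N] by (simp add: cong_def)
    moreover have "(D - a) div N = (D' - a) div N" using * by simp
    ultimately have "D - a = D' - a" by (metis div_mult_mod_eq)
    thus "D = D'" using * by simp
  qed
  hence "card {D \<in> {a..<a + S * N}. D mod N \<in> R} \<le> card ({..<S} \<times> R)"
    using assms by (intro card_inj_on_le[of ?f])
      (auto elim: inj_on_subset simp: div_less_iff_less_mult)
  thus ?thesis by (simp add: card_cartesian_product)
qed

text \<open>\<open>S\<close> need not be a multiple of \<open>N\<close>, so \<open>N\<close> periods
  are taken at once: they give \<open>N * l\<close> distinct values in an interval of length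
  \<open>S * N\<close>.\<close>

lemma period_times_modulus_le:
  fixes q :: "nat \<Rightarrow> nat"
  assumes "strict_mono q" "\<And>i. i \<ge> M \<Longrightarrow> q (i + l) = q i + S"
    and "finite R" "N > 0" "\<And>i. q i mod N \<in> R"
  shows "l * N \<le> S * card R"
proof -
  have q: "q (M + n * l) = q M + n * S" for n
  proof (induction n)
    case (Suc n)
    thus ?case using assms(2)[of "M + n * l"] by (simp add: algebra_simps)
  qed simp
  have "q ` {M..<M + N * l} \<subseteq> {D \<in> {q M..<q M + S * N}. D mod N \<in> R}"
    using assms(1,5) q[of N, symmetric]
    by (auto simp: strict_mono_less strict_mono_less_eq mult.commute[of S])
  hence "card (q ` {M..<M + N * l}) \<le> card {D \<in> {q M..<q M + S * N}. D mod N \<in> R}"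
    by (intro card_mono) auto
  also have "\<dots> \<le> S * card R" by (rule card_residues_interval_le[OF assms(3,4)])
  also have "card (q ` {M..<M + N * l}) = N * l"
    using assms(1) by (subst card_image) (auto intro: strict_mono_imp_inj_on inj_on_subset)
  finally show ?thesis by (simp add: mult.commute)
qed

text \<open>Truncated subtraction only increases the terms, so the numerator is at least
  \<open>S - n * l\<close> for a period of length \<open>l\<close> and total degree
  \<open>S\<close>; \<open>l / S\<close> is bounded by \<open>card R / N\<close>.\<close>

lemma (in quadratic_irrational) escape_ge:
  assumes x: "x = Th * fls_X_inv ^ k"
    and R: "finite R" "N > 0" "\<And>i. den_deg x i mod N \<in> R"
  shows "escape Th k n \<ge> 1 - real n * real (card R) / real N"
proof -
  define I where "I = {cf_preperiod x..<cf_preperiod x + cf_period x}"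
  define S where "S = (\<Sum>i\<in>I. tdeg (cf_pq x i))"
  have le: "cf_period x * N \<le> S * card R"
    using strict_mono_den_deg den_deg_period R unfolding S_def I_def
    by (rule period_times_modulus_le)
  have S: "S > 0"
    using le period_props(1) R(2) by (cases S) auto
  have "real S - real n * real (cf_period x) = (\<Sum>i\<in>I. real (tdeg (cf_pq x i)) - real n)"
    by (simp add: S_def I_def sum_subtractf)
  also have "\<dots> \<le> (\<Sum>i\<in>I. real (tdeg (cf_pq x i) - n))"
    by (intro sum_mono) linarith
  finally have "(real S - real n * real (cf_period x)) / real S \<le> escape Th k n"
    unfolding escape_def x[symmetric] Let_def I_def[symmetric]
    by (simp add: S_def divide_right_mono sum_nonneg)
  moreover have "real (cf_period x) / real S \<le> real (card R) / real N"
    using le S R(2) by (simp add: field_simps flip: of_nat_mult)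
  hence "real n * (real (cf_period x) / real S) \<le> real n * (real (card R) / real N)"
    by (intro mult_left_mono) auto
  ultimately show ?thesis using S by (simp add: diff_divide_distrib)
qed

subsection \<open>Dirichlet approximation\<close>

text \<open>A polynomial in t^h of degree at most \<open>h * e\<close> has \<open>e + 1\<close> free
  coefficients, while only the \<open>e\<close> coefficients of its product with \<open>W\<close> at
  \<open>h, ..., h * e\<close> must be killed.\<close>

lemma exists_approximation:
  fixes W :: "'a::{field,finite} fls"
  assumes W: "supp_dvd h W" and h: "h > 0"
  shows "\<exists>Q P. is_tpoly Q \<and> Q \<noteq> 0 \<and> val_ge Q (- int (h * e)) \<and> is_tpoly P
    \<and> val_ge (Q * W - P) (int (h * (e + 1)))"
proof -
  define Q where "Q = (\<lambda>c. \<Sum>j\<le>e. fls_const (c j :: 'a) * fls_X_inv ^ (h * j))"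
  define T where "T = (\<lambda>c. restrict (\<lambda>i. (Q c * W) $$ int (h * i)) {1..e})"
  let ?D = "{..e} \<rightarrow>\<^sub>E (UNIV :: 'a set)" and ?C = "{1..e} \<rightarrow>\<^sub>E (UNIV :: 'a set)"
  have Q_nth: "Q c $$ (- int (h * j)) = c j" if "j \<le> e" for c j
  proof -
    have "Q c $$ (- int (h * j)) = (\<Sum>i\<le>e. if i = j then c i else 0)"
      unfolding Q_def fls_nth_sum using h by (intro sum.cong) auto
    thus ?thesis using that by simp
  qed
  have "\<not> inj_on T ?D"
  proof (rule pigeonhole)
    have "T ` ?D \<subseteq> ?C" by (auto simp: T_def)
    hence "card (T ` ?D) \<le> card ?C" by (intro card_mono finite_PiE) auto
    also have "\<dots> < card ?D"
      using finite_UNIV_card_ge_0 card_mono[of UNIV "{0, 1 :: 'a}"] by (auto simp: card_PiE)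
    finally show "card (T ` ?D) < card ?D" .
  qed
  then obtain c c' where c: "c \<in> ?D" "c' \<in> ?D" "c \<noteq> c'" "T c = T c'"
    unfolding inj_on_def by blast
  define R where "R = Q c - Q c'"
  obtain j where j: "j \<le> e" "c j \<noteq> c' j"
    using c by (metis PiE_ext atMost_iff)
  have "R $$ (- int (h * j)) \<noteq> 0" 
    unfolding R_def fls_minus_nth Q_nth[OF j(1)] using j(2) by simp
  hence "R \<noteq> 0" by auto
  have "is_tpoly (Q c)" for c
    unfolding Q_def by (intro is_tpoly_sum is_tpoly_mult) (auto simp: is_tpoly_def mult_less_0_iff)
  hence "is_tpoly R" by (simp add: R_def)
  have "val_ge (Q c) (- int (h * e))" for c
    unfolding Q_def by (intro val_ge_sum) (auto simp: val_ge_def mult_less_cancel_left)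
  hence "val_ge R (- int (h * e))" unfolding R_def by (intro val_ge_diff)
  have "supp_dvd h (Q c)" for c
    unfolding supp_dvd_def
  proof (intro allI impI)
    fix n assume "Q c $$ n \<noteq> 0"
    then obtain j where "(fls_const (c j) * fls_X_inv ^ (h * j)) $$ n \<noteq> 0"
      unfolding Q_def fls_nth_sum by (meson sum.neutral)
    hence "n = - int (h * j)" by (simp split: if_splits)
    thus "int h dvd n" by simp
  qed
  hence "supp_dvd h R" unfolding R_def supp_dvd_def fls_minus_nth by (metis diff_zero)
  hence RW: "supp_dvd h (R * W)" using W by (rule supp_dvd_mult)
  \<comment> \<open>Multiples of \<open>h\<close> are handled by the collision
    \<open>T c = T c'\<close>, all other exponents by the support of the product.\<close>
  have "(R * W) $$ n = 0" if n: "n > 0" "n < int (h * (e + 1))" for n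
  proof (cases "int h dvd n")
    case True
    then obtain m where m: "n = int h * m" by auto
    have "m > 0" using n(1) h unfolding m by (simp add: zero_less_mult_iff)
    then obtain i where i: "m = int i" "i \<ge> 1"
      using zero_less_imp_eq_int by (metis Suc_leI One_nat_def)
    have "int (h * i) < int (h * (e + 1))" using n(2) m i by simp
    hence "i \<le> e" using h by (simp only: of_nat_less_iff nat_mult_less_cancel1)
    hence "(Q c * W) $$ int (h * i) = (Q c' * W) $$ int (h * i)"
      using fun_cong[OF c(4), of i] i by (simp add: T_def)
    thus ?thesis unfolding R_def m i by (simp add: left_diff_distrib)
  next
    case False thus ?thesis using RW unfolding supp_dvd_def by blast
  qed
  hence "val_ge (R * W - fls_ipart (R * W)) (int (h * (e + 1)))"
    by (auto simp: val_ge_def fls_ipart_nth)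
  thus ?thesis
    using \<open>R \<noteq> 0\<close> \<open>is_tpoly R\<close> \<open>val_ge R _\<close> is_tpoly_ipart by blast
qed

subsection \<open>The Cantor sequence\<close>

lemma length_cantor_phi [simp]: "length (cantor_phi p w) = p * length w"
  by (induction w) (simp_all add: cantor_phi_def)

lemma cantor_phi_nth:
  assumes "a < length w" "i < p"
  shows "cantor_phi p w ! (p * a + i) = cantor_letter p (w ! a) i"
  using assms
proof (induction w arbitrary: a)
  case (Cons n w)
  show ?case
  proof (cases a)
    case 0 thus ?thesis using Cons by (simp add: cantor_phi_def nth_append)
  next
    case (Suc b)
    have "cantor_phi p (n # w) = map (cantor_letter p n) [0..<p] @ cantor_phi p w"
      by (simp add: cantor_phi_def)
    thus ?thesis using Cons.IH[of b] Cons.prems Suc by (simp add: nth_append algebra_simps)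
  qed
qed simp

context
  fixes p :: nat
  assumes p: "odd p" "p > 1"
begin

abbreviation (input) "word n \<equiv> (cantor_phi p ^^ n) [1]"

lemma length_word: "length (word n) = p ^ n"
  by (induction n) auto

lemma word_Suc_nth: "a < p ^ n \<Longrightarrow> i < p \<Longrightarrow> word (Suc n) ! (p * a + i) = cantor_letter p (word n ! a) i"
  using cantor_phi_nth[of a "word n" i p] by (simp add: length_word del: One_nat_def)

text \<open>The image of the letter 1 begins with 1, so each word is a prefix of the next and the
  limit exists.\<close>

lemma word_prefix: "i < p ^ n \<Longrightarrow> word (Suc n) ! i = word n ! i"
proof (induction n arbitrary: i)
  case 0
  thus ?case using word_Suc_nth[of 0 0 0] p by (simp add: cantor_letter_def)
next
  case (Suc n)
  define a b where "a = i div p" and "b = i mod p"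
  have i: "i = p * a + b" "b < p" using p by (simp_all add: a_def b_def)
  have a: "a < p ^ n" using Suc.prems p by (simp add: a_def div_less_iff_less_mult mult.commute)
  have "p ^ n \<le> p ^ Suc n" using p by simp
  hence a': "a < p ^ Suc n" using a by linarith
  show ?case
    unfolding i(1) word_Suc_nth[OF a' i(2)] word_Suc_nth[OF a i(2)] Suc.IH[OF a] ..
qed

lemma word_prefix_le: "n \<le> m \<Longrightarrow> i < p ^ n \<Longrightarrow> word m ! i = word n ! i"
proof (induction m rule: dec_induct)
  case (step m)
  have "p ^ n \<le> p ^ m" using p step by (intro power_increasing) auto
  thus ?case using step word_prefix[of i m] by linarith
qed simp

lemma cantor_seq_eq_word:
  assumes "i < p ^ n"
  shows "cantor_seq p i = word n ! i"
  unfolding cantor_seq_def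
proof (rule the_equality)
  have "i < length (word m) \<and> word m ! i = word n ! i" if "m \<ge> n" for m
  proof -
    have "p ^ n \<le> p ^ m" using p that by (intro power_increasing) auto
    thus ?thesis using assms that by (simp add: length_word word_prefix_le del: One_nat_def)
  qed
  thus ev: "\<forall>\<^sub>F m in sequentially. i < length (word m) \<and> word m ! i = word n ! i"
    unfolding eventually_sequentially by blast
  fix a assume "\<forall>\<^sub>F m in sequentially. i < length (word m) \<and> word m ! i = a"
  with ev have "\<forall>\<^sub>F m in sequentially. a = word n ! i"
    by eventually_elim auto
  thus "a = word n ! i" by simp
qed

lemma cantor_seq_0: "cantor_seq p 0 = 1"
  using cantor_seq_eq_word[of 0 0] by simp

lemma cantor_seq_rec:
  assumes "i < p"
  shows "cantor_seq p (p * a + i) = cantor_letter p (cantor_seq p a) i"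
proof -
  \<comment> \<open>Hence level \<open>a\<close> is a convenient level at which the word already
    contains index \<open>a\<close>.\<close>
  have "a < p ^ a" using p by (intro power_gt_expt) auto
  moreover from this have "p * a + i < p ^ Suc a"
  proof -
    have "p * a + i < p * Suc a" using assms by simp
    also have "\<dots> \<le> p * p ^ a" using \<open>a < p ^ a\<close> by (intro mult_le_mono2) simp
    finally show ?thesis by simp
  qed
  ultimately show ?thesis
    using cantor_seq_eq_word[of a a] cantor_seq_eq_word[of "p * a + i" "Suc a"]
      word_Suc_nth[of a a i] assms by simp
qed

text \<open>In \<open>i = p * a + b\<close> with \<open>p\<close> and \<open>i\<close> odd, either
  the digit \<open>b\<close> is odd and its letter is 0, or \<open>a\<close> is odd and induction
  applies.\<close>

lemma cantor_seq_odd: "odd i \<Longrightarrow> cantor_seq p i = 0"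
proof (induction i rule: less_induct)
  case (less i)
  define a b where "a = i div p" and "b = i mod p"
  have i: "i = p * a + b" "b < p" using p by (simp_all add: a_def b_def)
  show ?case
  proof (cases "even b")
    case True
    hence "odd a" using less.prems i(1) by simp
    moreover have "a < i" using less.prems p unfolding a_def by (intro div_less_dividend) (auto elim: oddE)
    ultimately have "cantor_seq p a = 0" by (rule less.IH[rotated])
    thus ?thesis unfolding i(1) cantor_seq_rec[OF i(2)] by (simp add: cantor_letter_def)
  next
    case False
    thus ?thesis unfolding i(1) cantor_seq_rec[OF i(2)] by (simp add: cantor_letter_def)
  qed
qed

end

section \<open>Frobenius and the algebraic equation of the Cantor series\<close>

lemma fps_power_CHAR_nth:
  fixes f :: "'a::{field_prime_char} fps"
  shows "(f ^ CHAR('a)) $ n = (if CHAR('a) dvd n then (f $ (n div CHAR('a))) ^ CHAR('a) else 0)"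
proof -
  let ?p = "CHAR('a)"
  have p: "?p > 0" by simp
  \<comment> \<open>The freshman's dream is applied to the finite sum \<open>g\<close>; the
    remaining tail, raised to the power \<open>?p\<close>, starts beyond \<open>n\<close>.\<close>
  define g where "g = (\<Sum>i\<le>n. fps_const (f $ i) * fps_X ^ i)"
  define h where "h = fps_shift (Suc n) f"
  have f: "f = g + fps_X ^ Suc n * h"
  proof (rule fps_ext)
    fix m
    have "g $ m = (if m \<le> n then f $ m else 0)"
      by (simp add: g_def fps_sum_nth if_distrib[of "\<lambda>c. _ * c"] cong: if_cong)
    thus "f $ m = (g + fps_X ^ Suc n * h) $ m"
      by (auto simp: h_def fps_X_power_mult_nth simp del: power_Suc)
  qed
  have "f ^ ?p = g ^ ?p + (fps_X ^ Suc n * h) ^ ?p"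
    unfolding f by (rule freshmans_dream) auto
  also have "g ^ ?p = (\<Sum>i\<le>n. (fps_const (f $ i) * fps_X ^ i) ^ ?p)"
    unfolding g_def by (rule freshmans_dream_sum) auto
  also have "\<dots> = (\<Sum>i\<le>n. fps_const ((f $ i) ^ ?p) * fps_X ^ (i * ?p))"
    by (simp add: power_mult_distrib fps_const_power flip: power_mult)
  finally have "(f ^ ?p) $ n = (\<Sum>i\<le>n. (f $ i) ^ ?p * (if n = i * ?p then 1 else 0))
      + (fps_X ^ (Suc n * ?p) * h ^ ?p) $ n"
    by (simp only: fps_add_nth fps_sum_nth power_mult_distrib fps_mult_left_const_nth
        fps_X_power_nth flip: power_mult)
  moreover have "n < Suc n * ?p"
  proof -
    have "Suc n * 1 \<le> Suc n * ?p" using p by (intro mult_le_mono2) linarith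
    thus ?thesis by (simp only: mult_1_right Suc_le_eq)
  qed
  hence "(fps_X ^ (Suc n * ?p) * h ^ ?p) $ n = 0"
    unfolding fps_X_power_mult_nth by simp
  ultimately have eq: "(f ^ ?p) $ n = (\<Sum>i\<le>n. if n = i * ?p then (f $ i) ^ ?p else 0)"
    by (simp add: if_distrib[of "\<lambda>c. _ * c"] cong: if_cong)
  show ?thesis
  proof (cases "?p dvd n")
    case True
    then obtain j where j: "n = j * ?p" by (metis dvd_def mult.commute)
    have "j \<le> n" using p unfolding j by (simp add: Suc_le_eq)
    have "(f ^ ?p) $ n = (\<Sum>i\<le>n. if i = j then (f $ i) ^ ?p else 0)"
      unfolding eq using p j by (intro sum.cong) auto
    thus ?thesis using \<open>j \<le> n\<close> p j by simp
  next
    case False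
    thus ?thesis unfolding eq by (auto intro!: sum.neutral)
  qed
qed

lemma fps_one_plus_X2_power_nth:
  "((1 + fps_X\<^sup>2) ^ m :: 'a::comm_ring_1 fps) $ n = (if even n then of_nat (m choose (n div 2)) else 0)"
proof -
  have "(1 + fps_X\<^sup>2) ^ m = (\<Sum>k\<le>m. of_nat (m choose k) * (fps_X :: 'a fps) ^ (2 * k))"
    using binomial_ring[of "fps_X\<^sup>2 :: 'a fps" 1 m] by (simp add: power_mult add.commute)
  hence "((1 + fps_X\<^sup>2) ^ m :: 'a fps) $ n = (\<Sum>k\<le>m. of_nat (m choose k) * (if n = 2 * k then 1 else 0))"
    by (simp add: fps_sum_nth fps_mult_of_nat_nth)
  also have "\<dots> = (\<Sum>k\<le>m. if k = n div 2 \<and> even n then of_nat (m choose k) else 0)"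
    by (intro sum.cong) auto
  also have "\<dots> = (if even n then of_nat (m choose (n div 2)) else 0)"
    by (cases "even n"; cases "n div 2 \<le> m") (auto simp: binomial_eq_0)
  finally show ?thesis .
qed

definition cantor_fps :: "'p::prime_card mod_ring fps" where
  "cantor_fps = Abs_fps (\<lambda>i. of_nat (cantor_seq CARD('p) i))"

context
  assumes odd_p: "odd CARD('p::prime_card)"
begin

lemma CARD_gt_1: "CARD('p) > 1"
  using prime_card[where ?'a = 'p] prime_gt_1_nat by blast

text \<open>The power of \<open>1 + fps_X\<^sup>2\<close> has degree \<open>p - 1\<close> and the
  \<open>p\<close>-th power of the series lives on multiples of \<open>p\<close>, so the product
  picks the single splitting \<open>n = p * a + b\<close> of the recursion.\<close>

lemma cantor_fps_functional:
  "(cantor_fps :: 'p mod_ring fps) = (1 + fps_X\<^sup>2) ^ ((CARD('p) - 1) div 2) * cantor_fps ^ CARD('p)"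
proof (rule fps_ext)
  fix n
  let ?p = "CARD('p)" and ?f = "cantor_fps :: 'p mod_ring fps"
  let ?g = "(1 + fps_X\<^sup>2) ^ ((?p - 1) div 2) :: 'p mod_ring fps"
  define a b where "a = n div ?p" and "b = n mod ?p"
  have n: "n = ?p * a + b" "b < ?p" using CARD_gt_1 by (simp_all add: a_def b_def)
  have pow: "(?f ^ ?p) $ m = (if ?p dvd m then (?f $ (m div ?p)) ^ ?p else 0)" for m
    using fps_power_CHAR_nth[of ?f m] by simp
  have fermat: "c ^ ?p = c" for c :: "'p mod_ring"
    using finite_field_power_card_eq_same[of c] by simp
  have g0: "?g $ i = 0" if "i \<ge> ?p" for i
  proof -
    have "(?p - 1) div 2 < i div 2" if "even i"
      using that \<open>i \<ge> ?p\<close> odd_p by (elim evenE oddE) auto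
    thus ?thesis unfolding fps_one_plus_X2_power_nth by (simp add: binomial_eq_0)
  qed
  have "(?g * ?f ^ ?p) $ n = (\<Sum>i=0..n. ?g $ i * (?f ^ ?p) $ (n - i))"
    by (rule fps_mult_nth)
  also have "\<dots> = (\<Sum>i=0..n. if i = b then ?g $ b * ?f $ a else 0)"
  proof (intro sum.cong refl)
    fix i assume "i \<in> {0..n}"
    show "?g $ i * (?f ^ ?p) $ (n - i) = (if i = b then ?g $ b * ?f $ a else 0)"
    proof (cases "i < ?p \<and> ?p dvd n - i")
      case True
      hence "i mod ?p = b" unfolding b_def using \<open>i \<in> {0..n}\<close>
        by (metis atLeastAtMost_iff mod_eq_dvd_iff_nat)
      hence "i = b" using True by simp
      thus ?thesis using n CARD_gt_1 by (simp add: pow fermat)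
    next
      case False
      hence "i \<noteq> b" using n by auto
      thus ?thesis using False g0[of i] by (auto simp: pow)
    qed
  qed
  also have "\<dots> = ?g $ b * ?f $ a" using n by simp
  also have "\<dots> = ?f $ n"
    unfolding cantor_fps_def fps_nth_Abs_fps n(1) cantor_seq_rec[OF odd_p CARD_gt_1 n(2)]
      fps_one_plus_X2_power_nth cantor_letter_def
    using of_nat_mod_CHAR[where ?'a = "'p mod_ring"] by (auto simp: mult.commute)
  finally show "?f $ n = (?g * ?f ^ ?p) $ n" ..
qed

lemma cantor_fps_nth_0: "(cantor_fps :: 'p mod_ring fps) $ 0 = 1"
  by (simp add: cantor_fps_def cantor_seq_0[OF odd_p CARD_gt_1])

text \<open>For the left side \<open>h\<close>, the functional equation reads
  \<open>f = f * h ^ m\<close>. Thus \<open>h ^ m = 1\<close> and \<open>h ^ p = h\<close>, which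
  makes \<open>h\<close> constant.\<close>

lemma cantor_fps_square: "cantor_fps\<^sup>2 * (1 + fps_X\<^sup>2) = (1 :: 'p mod_ring fps)"
proof -
  let ?p = "CARD('p)" and ?f = "cantor_fps :: 'p mod_ring fps"
  define m where "m = (?p - 1) div 2"
  have p: "?p = Suc (2 * m)" using odd_p by (auto simp: m_def elim!: oddE)
  define h where "h = ?f\<^sup>2 * (1 + fps_X\<^sup>2)"
  have h0: "h $ 0 = 1" by (simp add: h_def cantor_fps_nth_0 power2_eq_square)
  have "?f * 1 = ?f * h ^ m"
    using cantor_fps_functional unfolding h_def m_def[symmetric] p
    by (simp add: power_mult_distrib mult_ac flip: power_mult)
  moreover have "?f \<noteq> 0" using cantor_fps_nth_0 by auto
  ultimately have hm: "h ^ m = 1" by (metis mult_left_cancel)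
  have "h ^ ?p = h * (h ^ m) ^ 2"
    unfolding p by (simp flip: power_mult add: mult.commute)
  hence hp: "h ^ ?p = h" unfolding hm by simp
  \<comment> \<open>As \<open>h\<close> equals its \<open>p\<close>-th power, a nonzero coefficient
    at \<open>n\<close> would force one at \<open>n div p\<close>.\<close>
  have "h $ n = 0" if "n > 0" for n
    using that
  proof (induction n rule: less_induct)
    case (less n)
    have "h $ n = (if ?p dvd n then (h $ (n div ?p)) ^ ?p else 0)"
      using fps_power_CHAR_nth[of h n] unfolding semiring_char_mod_ring hp .
    moreover have "h $ (n div ?p) = 0" if "?p dvd n"
      using that less CARD_gt_1 by (intro less.IH) (auto elim!: dvdE)
    ultimately show ?case using CARD_gt_1 by (auto simp: power_0_left)
  qed
  hence "h = 1" using h0 by (intro fps_ext) (auto simp: fps_one_nth)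
  thus ?thesis by (simp add: h_def)
qed

end

lemma supp_dvd_fps_to_fls: "supp_dvd h (fps_to_fls f) \<longleftrightarrow> (\<forall>n. fps_nth f n \<noteq> 0 \<longrightarrow> h dvd n)"
proof
  show "\<forall>n. fps_nth f n \<noteq> 0 \<longrightarrow> h dvd n" if "supp_dvd h (fps_to_fls f)"
  proof (intro allI impI)
    fix n assume "fps_nth f n \<noteq> 0"
    thus "h dvd n" using that[unfolded supp_dvd_def, rule_format, of "int n"] by simp
  qed
  show "supp_dvd h (fps_to_fls f)" if f: "\<forall>n. fps_nth f n \<noteq> 0 \<longrightarrow> h dvd n"
    unfolding supp_dvd_def
  proof (intro allI impI)
    fix n assume "fps_to_fls f $$ n \<noteq> 0"
    thus "int h dvd n" using f by (cases n) (auto split: if_splits)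
  qed
qed

lemma supp_dvd_fps_power_CHAR:
  fixes f :: "'a::{field_prime_char} fps"
  assumes "supp_dvd h (fps_to_fls f)"
  shows "supp_dvd (h * CHAR('a)) (fps_to_fls (f ^ CHAR('a)))"
  unfolding supp_dvd_fps_to_fls
proof (intro allI impI)
  fix n assume n: "fps_nth (f ^ CHAR('a)) n \<noteq> 0"
  hence dvd: "CHAR('a) dvd n" by (metis fps_power_CHAR_nth)
  hence "fps_nth f (n div CHAR('a)) \<noteq> 0"
    using n by (auto simp: fps_power_CHAR_nth power_0_left)
  hence "h dvd n div CHAR('a)" using assms unfolding supp_dvd_fps_to_fls by blast
  hence "h * CHAR('a) dvd n div CHAR('a) * CHAR('a)" by (rule mult_dvd_mono) simp
  thus "h * CHAR('a) dvd n" using dvd by simp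
qed

text \<open>The series is even, which gives the factor 2; each Frobenius power multiplies the
  exponents by \<open>p\<close>.\<close>

lemma supp_dvd_cantor_fps_power:
  assumes "odd CARD('p::prime_card)"
  shows "supp_dvd (2 * CARD('p) ^ s) (fps_to_fls (cantor_fps :: 'p mod_ring fps) ^ (CARD('p) ^ s))"
proof -
  let ?f = "cantor_fps :: 'p mod_ring fps"
  have "supp_dvd (2 * CARD('p) ^ s) (fps_to_fls (?f ^ (CARD('p) ^ s)))"
  proof (induction s)
    case 0
    have "even n" if "fps_nth ?f n \<noteq> 0" for n
      using that cantor_seq_odd[OF assms CARD_gt_1[OF assms], of n] by (cases "even n") (simp_all add: cantor_fps_def)
    thus ?case by (simp add: supp_dvd_fps_to_fls)
  next
    case (Suc s)
    show ?case using supp_dvd_fps_power_CHAR[OF Suc] by (simp add: mult_ac flip: power_mult)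
  qed
  thus ?thesis by (simp add: fps_to_fls_power)
qed

subsection \<open>Density\<close>

text \<open>\<open>k\<close> is outside \<open>bad_set q J\<close> iff \<open>k = N a + r\<close> with \<open>a\<close> odd and \<open>r < 2 N / q\<close> for some
  \<open>N = q\<^sup>j\<close>, \<open>1 \<le> j \<le> J\<close>.\<close>
definition bad_set :: "nat \<Rightarrow> nat \<Rightarrow> nat set" where
  "bad_set q J = {k. \<forall>j<J. k mod (2 * q ^ Suc j) \<notin> {q ^ Suc j..<q ^ Suc j + 2 * q ^ j}}"

lemma mod_2_power_mod:
  fixes q :: nat
  assumes "j \<le> J"
  shows "k mod (2 * q ^ J) mod (2 * q ^ j) = k mod (2 * q ^ j)"
  using assms by (intro mod_mod_cancel) (auto intro: le_imp_power_dvd)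

lemma bad_set_mod: "k mod (2 * q ^ J) \<in> bad_set q J \<longleftrightarrow> k \<in> bad_set q J"
  unfolding bad_set_def by (auto simp: mod_2_power_mod Suc_leI simp del: power_Suc)

text \<open>Among the \<open>q\<close> lifts of a residue modulo \<open>2 q\<^sup>J\<close> to one modulo \<open>2 q\<^sup>J\<^sup>+\<^sup>1\<close>, exactly one lies in
  the interval of length \<open>2 q\<^sup>J\<close> that is removed at the next level.\<close>
lemma card_bad_set_le:
  assumes "odd q" "q > 1"
  shows "card (bad_set q J \<inter> {..<2 * q ^ J}) \<le> 2 * (q - 1) ^ J"
proof (induction J)
  case 0 thus ?case by (simp add: bad_set_def)
next
  case (Suc J)
  define M where "M = q ^ J"
  have M: "M > 0" using assms by (simp add: M_def)
  obtain h where h: "q = 2 * h + 1" "h \<ge> 1" using assms by (auto elim!: oddE)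
  \<comment> \<open>The removed interval starts at \<open>q * M = 2 * M * h + M\<close>, the middle
    of block \<open>h\<close>, and ends in the middle of block \<open>h + 1\<close>.\<close>
  define i0 where "i0 = (\<lambda>x. if x \<ge> M then h else h + 1)"
  let ?B = "bad_set q J \<inter> {..<2 * M}"
  let ?f = "\<lambda>k. (k mod (2 * M), k div (2 * M))"
  have "inj_on ?f (bad_set q (Suc J) \<inter> {..<2 * q ^ Suc J})"
    by (intro inj_onI) (metis Pair_inject div_mult_mod_eq)
  moreover have "?f k \<in> Sigma ?B (\<lambda>x. {..<q} - {i0 x})"
    if k: "k \<in> bad_set q (Suc J)" "k < 2 * q ^ Suc J" for k
  proof -
    define x where "x = k mod (2 * M)"
    define i where "i = k div (2 * M)"
    have k_eq: "k = 2 * M * i + x" by (simp add: x_def i_def)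
    have x: "x < 2 * M" using M by (simp add: x_def)
    have "k \<in> bad_set q J" using k(1) by (auto simp: bad_set_def)
    hence "x \<in> bad_set q J" unfolding x_def M_def bad_set_mod .
    moreover have "i < q"
      using k(2) M by (simp add: i_def M_def div_less_iff_less_mult algebra_simps)
    moreover have "i \<noteq> i0 x"
    proof
      assume i: "i = i0 x"
      have "k mod (2 * q ^ Suc J) = k" using k(2) by simp
      hence "k \<notin> {q * M..<q * M + 2 * M}" using k(1) unfolding bad_set_def M_def by force
      moreover have "q * M = 2 * M * h + M" by (simp add: h algebra_simps)
      ultimately show False
        using x i unfolding k_eq i0_def by (auto split: if_splits simp: algebra_simps)
    qed
    ultimately show ?thesis using x unfolding x_def i_def by auto
  qed
  ultimately have "card (bad_set q (Suc J) \<inter> {..<2 * q ^ Suc J})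
      \<le> card (Sigma ?B (\<lambda>x. {..<q} - {i0 x}))"
    by (intro card_inj_on_le[of ?f]) auto
  also have "\<dots> = (\<Sum>x\<in>?B. card ({..<q} - {i0 x}))"
    by (intro card_SigmaI) auto
  also have "\<dots> = (\<Sum>x\<in>?B. q - 1)"
    \<comment> \<open>\<open>h >= 1\<close> gives \<open>h + 1 < q\<close>, so one lift is really
      removed.\<close>
    using h by (intro sum.cong) (auto simp: i0_def card_Diff_subset)
  also have "\<dots> = card ?B * (q - 1)" by simp
  also have "\<dots> \<le> 2 * (q - 1) ^ J * (q - 1)"
    using Suc by (intro mult_right_mono) (auto simp: M_def)
  finally show ?case by (simp add: mult.commute mult.assoc)
qed

lemma card_bad_set_atMost_le:
  assumes "odd q" "q > 1"
  shows "card (bad_set q J \<inter> {1..m}) \<le> (m div (2 * q ^ J) + 1) * (2 * (q - 1) ^ J)"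
proof -
  define M where "M = 2 * q ^ J"
  have M: "M > 0" using assms by (simp add: M_def)
  have mod: "k mod M \<in> bad_set q J \<longleftrightarrow> k \<in> bad_set q J" for k
    unfolding M_def by (rule bad_set_mod)
  let ?f = "\<lambda>k. (k div M, k mod M)"
  have "inj_on ?f (bad_set q J \<inter> {1..m})"
    by (intro inj_onI) (metis Pair_inject div_mult_mod_eq)
  moreover have "?f ` (bad_set q J \<inter> {1..m}) \<subseteq> {..m div M} \<times> (bad_set q J \<inter> {..<M})"
    using M by (auto simp: mod div_le_mono)
  ultimately have "card (bad_set q J \<inter> {1..m}) \<le> card ({..m div M} \<times> (bad_set q J \<inter> {..<M}))"
    by (intro card_inj_on_le[of ?f]) auto
  also have "\<dots> = (m div M + 1) * card (bad_set q J \<inter> {..<M})" by simp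
  also have "\<dots> \<le> (m div M + 1) * (2 * (q - 1) ^ J)"
    using card_bad_set_le[OF assms, of J] unfolding M_def by (intro mult_left_mono) auto
  finally show ?thesis unfolding M_def .
qed

text \<open>The complement has at most \<open>c ^ J * m + K\<close> elements up to \<open>m\<close>,
  with \<open>c = 1 - 1 / q\<close>: first \<open>J\<close> is chosen to make \<open>c ^ J\<close>
  small, then \<open>m\<close> to absorb the incomplete period \<open>K\<close>.\<close>

lemma nat_density_eq_1:
  assumes q: "odd q" "q > 1" and A: "\<And>J. - A \<subseteq> bad_set q J"
  shows "nat_density A = 1"
  unfolding nat_density_def
proof (rule limI, rule LIMSEQ_I)
  fix \<epsilon> :: real assume \<epsilon>: "\<epsilon> > 0"
  define c where "c = 1 - 1 / real q"
  have c: "0 \<le> c" "c < 1" using q by (auto simp: c_def)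
  obtain J where J: "c ^ J < \<epsilon> / 2"
    using real_arch_pow_inv[of "\<epsilon> / 2" c] \<epsilon> c by auto
  define K where "K = 2 * real ((q - 1) ^ J)"
  have K: "K = 2 * c ^ J * real q ^ J"
  proof -
    have "real (q - 1) = c * real q"
      using q by (simp add: c_def of_nat_diff left_diff_distrib)
    thus ?thesis by (simp add: K_def power_mult_distrib)
  qed
  obtain m0 :: nat where m0: "real m0 > 2 * K / \<epsilon>" using reals_Archimedean2 by blast
  show "\<exists>m0. \<forall>m\<ge>m0. norm (real (card (A \<inter> {1..m})) / real m - 1) < \<epsilon>"
  proof (intro exI allI impI)
    fix m assume m: "m \<ge> max m0 1"
    hence mpos: "real m > 0" by simp
    have "card {1..m} = card ((A \<inter> {1..m}) \<union> (- A \<inter> {1..m}))"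
      by (rule arg_cong[where f = card]) blast
    also have "card ((A \<inter> {1..m}) \<union> (- A \<inter> {1..m})) = card (A \<inter> {1..m}) + card (- A \<inter> {1..m})"
      by (intro card_Un_disjoint) auto
    finally have eq: "real (card (A \<inter> {1..m})) = real m - real (card (- A \<inter> {1..m}))"
      unfolding card_atLeastAtMost by linarith
    have "card (- A \<inter> {1..m}) \<le> card (bad_set q J \<inter> {1..m})"
      using A by (intro card_mono) auto
    also have "\<dots> \<le> (m div (2 * q ^ J) + 1) * (2 * (q - 1) ^ J)"
      by (rule card_bad_set_atMost_le[OF q])
    finally have "real (card (- A \<inter> {1..m})) \<le> real ((m div (2 * q ^ J) + 1) * (2 * (q - 1) ^ J))"
      by (simp only: of_nat_le_iff)
    also have "\<dots> = (real (m div (2 * q ^ J)) + 1) * K"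
      by (simp add: K_def distrib_right)
    also have "\<dots> \<le> (real m / (2 * real q ^ J) + 1) * K"
      using of_nat_div_le_of_nat[of m "2 * q ^ J", where ?'a = real] by (intro mult_right_mono) (auto simp: K_def)
    also have "\<dots> = c ^ J * real m + K"
      using q unfolding K by (simp add: distrib_right)
    also have "\<dots> < \<epsilon> / 2 * real m + \<epsilon> / 2 * real m"
    proof (rule add_strict_mono)
      show "c ^ J * real m < \<epsilon> / 2 * real m" using J mpos by simp
      have "2 * K / \<epsilon> < real m" using m0 m by linarith
      thus "K < \<epsilon> / 2 * real m" using \<epsilon> by (simp add: field_simps)
    qed
    finally have "real (card (- A \<inter> {1..m})) < \<epsilon> * real m" by simp
    moreover have "real (card (A \<inter> {1..m})) / real m - 1 = - (real (card (- A \<inter> {1..m})) / real m)"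
      unfolding eq using mpos by (simp add: diff_divide_distrib)
    ultimately show "norm (real (card (A \<inter> {1..m})) / real m - 1) < \<epsilon>"
      using mpos by (simp add: pos_divide_less_eq)
  qed
qed

subsection \<open>Escape of mass\<close>

context
  assumes odd_p: "odd CARD('p::prime_card)"
begin

abbreviation (input) "\<tau> \<equiv> (fls_X_inv :: 'p mod_ring fls)"

lemma X_tau: "fls_X * \<tau> = 1"
  using right_inverse[of "fls_X :: 'p mod_ring fls"] by (simp only: fls_inverse_X fls_X_nonzero) simp

lemma Theta_eq: "(Theta :: 'p mod_ring fls) = fls_X * fps_to_fls cantor_fps"
  by (simp add: Theta_def cantor_fps_def)

lemma Theta_square: "(Theta :: 'p mod_ring fls)\<^sup>2 * (1 + \<tau>\<^sup>2) = 1"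
proof -
  have "fps_to_fls (cantor_fps\<^sup>2 * (1 + fps_X\<^sup>2)) = (1 :: 'p mod_ring fls)"
    unfolding cantor_fps_square[OF odd_p] by simp
  hence 1: "(fps_to_fls cantor_fps)\<^sup>2 * (1 + fls_X\<^sup>2) = (1 :: 'p mod_ring fls)"
    by (simp add: fls_times_fps_to_fls fps_to_fls_power)
  have "(Theta :: 'p mod_ring fls)\<^sup>2 * (1 + \<tau>\<^sup>2)
      = (fps_to_fls cantor_fps)\<^sup>2 * (fls_X\<^sup>2 + (fls_X * \<tau>)\<^sup>2)"
    by (simp add: Theta_eq algebra_simps power_mult_distrib)
  thus ?thesis using 1 by (simp add: X_tau add.commute)
qed

text \<open>Infinite descent: if \<open>\<alpha> = \<surd>(1 + t\<^sup>2)\<close> has denominator \<open>P\<close>, then \<open>P (\<alpha> - t)\<close> is a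
  denominator of smaller degree.\<close>
lemma irrational_Theta: "irrational_fls ((Theta :: 'p mod_ring fls) * \<tau> ^ k)"
  unfolding irrational_fls_def
proof (intro allI impI, elim conjE)
  define \<alpha> where "\<alpha> = (1 + \<tau>\<^sup>2) * Theta"
  have \<alpha>_Theta: "\<alpha> * Theta = 1"
    using Theta_square by (simp add: \<alpha>_def power2_eq_square algebra_simps)
  have \<alpha>2: "\<alpha>\<^sup>2 = 1 + \<tau>\<^sup>2"
  proof -
    have "\<alpha>\<^sup>2 = (1 + \<tau>\<^sup>2) * (Theta\<^sup>2 * (1 + \<tau>\<^sup>2))"
      by (simp add: \<alpha>_def power2_eq_square mult_ac)
    thus ?thesis by (simp add: Theta_square)
  qed
  hence neq: "\<alpha> \<noteq> \<tau>" by auto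
  \<comment> \<open>The difference \<open>\<alpha> - \<tau>\<close> is \<open>\<tau>\<close> times
    \<open>u\<close>. Since the constant and the linear coefficient of \<open>u\<close> vanish, it
    has negative degree in t.\<close>
  define u :: "'p mod_ring fps" where "u = (1 + fps_X\<^sup>2) * cantor_fps - 1"
  have u: "u $ 0 = 0" "u $ 1 = 0"
    using cantor_seq_odd[OF odd_p CARD_gt_1[OF odd_p], of 1]
    by (simp_all add: u_def distrib_right fps_X_power_mult_nth cantor_fps_nth_0[OF odd_p])
       (simp add: cantor_fps_def)
  have "\<alpha> - \<tau> = \<tau> * fps_to_fls u"
  proof -
    have "(1 + \<tau>\<^sup>2) * fls_X = fls_X + \<tau> * (fls_X * \<tau>)"
      by (simp add: power2_eq_square algebra_simps)
    also have "\<dots> = \<tau> + fls_X * (fls_X * \<tau>)" unfolding X_tau by simp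
    also have "\<dots> = \<tau> * (1 + fls_X\<^sup>2)"
      by (simp add: power2_eq_square algebra_simps)
    finally have "\<alpha> = \<tau> * (1 + fls_X\<^sup>2) * fps_to_fls cantor_fps"
      by (simp add: \<alpha>_def Theta_eq flip: mult.assoc)
    thus ?thesis by (simp add: u_def fls_times_fps_to_fls fps_to_fls_power right_diff_distrib mult.assoc)
  qed
  moreover have "val_ge (fps_to_fls u) 2"
    unfolding val_ge_def
  proof (intro allI impI)
    fix n :: int assume "n < 2"
    hence "n < 0 \<or> nat n = 0 \<or> nat n = 1" by linarith
    thus "fps_to_fls u $$ n = 0" using u by auto
  qed
  ultimately have val_ge: "val_ge (\<alpha> - \<tau>) 1"
    using val_ge_mult[of \<tau> "- 1" "fps_to_fls u" 2] by (simp add: val_ge_def)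
  have descent: "P = 0" if "is_tpoly P" "is_tpoly (P * \<alpha>)" "val_ge P (1 - int n)" for P n
    using that
  proof (induction n arbitrary: P)
    case 0
    thus ?case using is_tpoly_val_ge_pos_eq_0[of P 1] by simp
  next
    case (Suc n)
    have "P * (\<alpha> - \<tau>) * \<alpha> = P * \<alpha>\<^sup>2 - \<tau> * (P * \<alpha>)"
      by (simp add: power2_eq_square algebra_simps)
    hence "is_tpoly (P * (\<alpha> - \<tau>) * \<alpha>)" using Suc.prems by (simp add: \<alpha>2)
    moreover have "is_tpoly (P * (\<alpha> - \<tau>))"
      using Suc.prems by (simp add: right_diff_distrib)
    moreover have "val_ge (P * (\<alpha> - \<tau>)) (1 - int n)"
      using val_ge_mult[OF Suc.prems(3) val_ge] by (simp add: algebra_simps)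
    ultimately have "P * (\<alpha> - \<tau>) = 0" using Suc.IH by blast
    thus ?case using neq by simp
  qed
  fix Q assume Q: "is_tpoly Q" "is_tpoly (Q * (Theta * \<tau> ^ k))"
  define P where "P = Q * (Theta * \<tau> ^ k)"
  \<comment> \<open>A denominator \<open>Q\<close> of the given series thus yields a denominator
    \<open>P\<close> of \<open>\<alpha>\<close>, to which the descent applies.\<close>
  have "P * \<alpha> = Q * \<tau> ^ k * (\<alpha> * Theta)" by (simp add: P_def mult_ac)
  hence P\<alpha>: "P * \<alpha> = Q * \<tau> ^ k" by (simp add: \<alpha>_Theta)
  have "P = 0"
  proof (rule descent)
    show "is_tpoly P" using Q by (simp add: P_def)
    show "is_tpoly (P * \<alpha>)" unfolding P\<alpha> using Q by simp
    show "val_ge P (1 - int (nat (1 - fls_subdegree P)))"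
      using val_ge_subdegree by (rule val_ge_mono) simp
  qed
  thus "Q = 0" using P\<alpha> by simp
qed

text \<open>\<open>Theta_square\<close> lets \<open>f\<close> be replaced by
  \<open>f ^ N * (fls_X\<^sup>2 * (1 + \<tau>\<^sup>2)) ^ m\<close>; then \<open>fls_X ^ N\<close>
  cancels one \<open>\<tau> ^ N\<close>. The odd multiple of \<open>N\<close> leaves an even one, as
  the support of \<open>W\<close> requires.\<close>

lemma Theta_frobenius:
  assumes "N = Suc (2 * m)"
  shows "(Theta :: 'p mod_ring fls) * \<tau> ^ (N * Suc (2 * b) + r)
    = \<tau> ^ r * (1 + \<tau>\<^sup>2) ^ m * (\<tau> ^ (2 * N * b) * fps_to_fls cantor_fps ^ N)"
proof -
  let ?f = "fps_to_fls cantor_fps :: 'p mod_ring fls"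
  have fX: "?f\<^sup>2 * (fls_X\<^sup>2 * (1 + \<tau>\<^sup>2)) = 1"
    using Theta_square by (simp add: Theta_eq power_mult_distrib mult_ac)
  have "?f ^ N * (fls_X ^ (2 * m) * (1 + \<tau>\<^sup>2) ^ m)
      = ?f * (?f\<^sup>2 * (fls_X\<^sup>2 * (1 + \<tau>\<^sup>2))) ^ m"
    unfolding assms by (simp add: power_mult_distrib mult_ac flip: power_mult)
  hence f: "?f = ?f ^ N * (fls_X ^ (2 * m) * (1 + \<tau>\<^sup>2) ^ m)" unfolding fX by simp
  have "Theta * \<tau> ^ (N * Suc (2 * b) + r)
      = fls_X * (?f ^ N * (fls_X ^ (2 * m) * (1 + \<tau>\<^sup>2) ^ m)) * \<tau> ^ (N * Suc (2 * b) + r)"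
    unfolding Theta_eq by (subst f) (rule refl)
  also have "\<dots> = (fls_X * \<tau>) ^ N * (\<tau> ^ r * (1 + \<tau>\<^sup>2) ^ m * (\<tau> ^ (2 * N * b) * ?f ^ N))"
  proof -
    have 1: "(fls_X * \<tau>) ^ N = fls_X * fls_X ^ (2 * m) * \<tau> ^ N"
      by (simp add: assms power_mult_distrib)
    have 2: "\<tau> ^ (N * Suc (2 * b) + r) = \<tau> ^ N * \<tau> ^ r * \<tau> ^ (2 * N * b)"
      by (simp add: mult_ac add_ac flip: power_add)
    show ?thesis unfolding 1 2 by (simp only: mult_ac)
  qed
  finally show ?thesis by (simp add: X_tau)
qed

lemma quadratic_irrational_Theta:
  "quadratic_irrational ((Theta :: 'p mod_ring fls) * \<tau> ^ k) (1 + \<tau>\<^sup>2)"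
proof unfold_locales
  show "irrational_fls (Theta * \<tau> ^ k)" by (rule irrational_Theta)
  show "is_tpoly (1 + \<tau>\<^sup>2)" by simp
  show "1 + \<tau>\<^sup>2 \<noteq> 0" using Theta_square by auto
  have "(1 + \<tau>\<^sup>2) * (Theta * \<tau> ^ k)\<^sup>2 = (Theta\<^sup>2 * (1 + \<tau>\<^sup>2)) * (\<tau> ^ k)\<^sup>2"
    by (simp add: power_mult_distrib mult_ac)
  thus "is_tpoly ((1 + \<tau>\<^sup>2) * (Theta * \<tau> ^ k)\<^sup>2)" by (simp add: Theta_square)
qed

text \<open>A degree \<open>D = N * c + v\<close> with \<open>2 <= v < N - r\<close> is excluded by
  an approximation fit for \<open>den_deg_neq\<close>. Dirichlet degrees are spaced by
  \<open>2 * N\<close>, so the parity of \<open>c\<close> decides which of two series is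
  approximated.\<close>

lemma den_deg_Theta_residue:
  fixes b r s :: nat
  assumes N: "N = CARD('p) ^ s" and r: "r < N"
  defines "x \<equiv> (Theta :: 'p mod_ring fls) * \<tau> ^ (N * Suc (2 * b) + r)"
  shows "den_deg x i mod N \<in> {0, 1} \<union> {N - r..<N}"
proof (rule ccontr)
  interpret quadratic_irrational x "1 + \<tau>\<^sup>2"
    unfolding x_def by (rule quadratic_irrational_Theta)
  define D where "D = den_deg x i"
  define v where "v = D mod N"
  define c where "c = D div N"
  assume "\<not> ?thesis"
  moreover have "v < N" using r by (simp add: v_def)
  ultimately have v: "v \<ge> 2" "v + r < N" by (auto simp: v_def D_def)
  have D: "D = N * c + v" by (simp add: c_def v_def)
  have "odd N" using odd_p by (simp add: N)
  then obtain m where m: "N = Suc (2 * m)" by (auto elim!: oddE)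
  define W where "W = \<tau> ^ (2 * N * b) * fps_to_fls cantor_fps ^ N"
  have x: "x = \<tau> ^ r * (1 + \<tau>\<^sup>2) ^ m * W"
    unfolding x_def W_def by (rule Theta_frobenius[OF m])
  have W: "supp_dvd (2 * N) W"
    unfolding W_def using supp_dvd_cantor_fps_power[OF odd_p, of s]
    by (intro supp_dvd_mult supp_dvd_X_inv_power) (simp_all add: N)
  have \<tau>: "val_ge \<tau> (- 1)" and E: "val_ge (1 + \<tau>\<^sup>2) (- 2)"
    by (auto simp: val_ge_def)
  have \<tau>r: "val_ge (\<tau> ^ r) (- int r)" using val_ge_power[OF \<tau>, of r] by simp
  have Em: "val_ge ((1 + \<tau>\<^sup>2) ^ m) (- 2 * int m)" for m
    using val_ge_power[OF E, of m] by (simp add: mult.commute)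
  show False
  proof (cases "even c")
    case True
    then obtain e where e: "c = 2 * e" by auto
    obtain Q P where Q: "is_tpoly Q" "Q \<noteq> 0" "val_ge Q (- int (2 * N * e))" "is_tpoly P"
        "val_ge (Q * W - P) (int (2 * N * (e + 1)))"
      using exists_approximation[OF W, of e] r by auto
    \<comment> \<open>\<open>Q\<close> has degree at most \<open>N * c\<close>. The factor t^r (1 +
      t^2)^m costs \<open>r + 2 * m = r + N - 1\<close> of the valuation
      \<open>N * c + 2 * N\<close>.\<close>
    have "den_deg x i \<noteq> D"
    proof (rule den_deg_neq[OF Q(1) _ Q(2)])
      show "is_tpoly (\<tau> ^ r * (1 + \<tau>\<^sup>2) ^ m * P)" using Q by simp
      show "val_ge Q (1 - int D)" using v by (intro val_ge_mono[OF Q(3)]) (simp add: D e)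
      have v': "val_ge (\<tau> ^ r * (1 + \<tau>\<^sup>2) ^ m * (Q * W - P)) (- int r + - 2 * int m + int (2 * N * (e + 1)))"
        by (intro val_ge_mult \<tau>r Em Q)
      have eq: "Q * x - \<tau> ^ r * (1 + \<tau>\<^sup>2) ^ m * P = \<tau> ^ r * (1 + \<tau>\<^sup>2) ^ m * (Q * W - P)"
        unfolding x by (simp add: left_diff_distrib right_diff_distrib mult_ac)
      have "int D + 1 \<le> - int r + - 2 * int m + int (2 * N * (e + 1))"
        using v m by (simp add: D e algebra_simps)
      thus "val_ge (Q * x - \<tau> ^ r * (1 + \<tau>\<^sup>2) ^ m * P) (int D + 1)"
        unfolding eq by (rule val_ge_mono[OF v'])
    qed
    thus False by (simp add: D_def)
  next
    case False
    then obtain e where e: "c = 2 * e + 1" by (auto elim: oddE)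
    \<comment> \<open>This is where \<open>N\<close> being a power of \<open>p\<close> keeps the
      second series supported on multiples of \<open>2 * N\<close>.\<close>
    have "(1 + \<tau>\<^sup>2) ^ N = 1 ^ N + (\<tau>\<^sup>2) ^ N"
      by (rule freshmans_dream'[where n = s]) (simp_all add: N prime_card)
    hence "supp_dvd (2 * N) ((1 + \<tau>\<^sup>2) ^ N)"
      by (auto simp flip: power_mult intro!: supp_dvd_add supp_dvd_X_inv_power)
    hence "supp_dvd (2 * N) ((1 + \<tau>\<^sup>2) ^ N * W)" using W by (rule supp_dvd_mult)
    then obtain Q P where Q: "is_tpoly Q" "Q \<noteq> 0" "val_ge Q (- int (2 * N * e))" "is_tpoly P"
        "val_ge (Q * ((1 + \<tau>\<^sup>2) ^ N * W) - P) (int (2 * N * (e + 1)))"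
      using exists_approximation[of "2 * N" "(1 + \<tau>\<^sup>2) ^ N * W" e] r by auto
    \<comment> \<open>Moving \<open>m + 1\<close> of the \<open>2 * m + 1\<close> factors into the
      denominator brings its degree to at most \<open>N * c + 1\<close>, below \<open>D\<close> as
      \<open>v >= 2\<close>. The error loses only t^r, which \<open>v + r < N\<close>
      allows.\<close>
    have "den_deg x i \<noteq> D"
    proof (rule den_deg_neq)
      show "is_tpoly (Q * (1 + \<tau>\<^sup>2) ^ Suc m)" "is_tpoly (\<tau> ^ r * P)" using Q by simp_all
      have "1 + \<tau>\<^sup>2 \<noteq> 0" using Theta_square by auto
      thus "Q * (1 + \<tau>\<^sup>2) ^ Suc m \<noteq> 0" using Q by simp
      have "val_ge (Q * (1 + \<tau>\<^sup>2) ^ Suc m) (- int (2 * N * e) + - 2 * int (Suc m))"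
        by (intro val_ge_mult Em Q)
      thus "val_ge (Q * (1 + \<tau>\<^sup>2) ^ Suc m) (1 - int D)"
        by (rule val_ge_mono) (use v m in \<open>simp add: D e algebra_simps\<close>)
      have v': "val_ge (\<tau> ^ r * (Q * ((1 + \<tau>\<^sup>2) ^ N * W) - P)) (- int r + int (2 * N * (e + 1)))"
        by (intro val_ge_mult \<tau>r Q)
      have eq: "Q * (1 + \<tau>\<^sup>2) ^ Suc m * x - \<tau> ^ r * P
          = \<tau> ^ r * (Q * ((1 + \<tau>\<^sup>2) ^ N * W) - P)"
      proof -
        have "(1 + \<tau>\<^sup>2) ^ N = (1 + \<tau>\<^sup>2) ^ Suc m * (1 + \<tau>\<^sup>2) ^ m"
          unfolding m by (simp add: mult_2 power_add)
        thus ?thesis unfolding x by (simp only: right_diff_distrib mult_ac)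
      qed
      have "int D + 1 \<le> - int r + int (2 * N * (e + 1))"
        using v by (simp add: D e algebra_simps)
      thus "val_ge (Q * (1 + \<tau>\<^sup>2) ^ Suc m * x - \<tau> ^ r * P) (int D + 1)"
        unfolding eq by (rule val_ge_mono[OF v'])
    qed
    thus False by (simp add: D_def)
  qed
qed

lemma escape_Theta_ge:
  assumes N: "N = CARD('p) ^ s" and r: "r < N"
  shows "escape (Theta :: 'p mod_ring fls) (N * Suc (2 * b) + r) n
    \<ge> 1 - real n * real (r + 2) / real N"
proof -
  let ?k = "N * Suc (2 * b) + r" and ?R = "{0, 1} \<union> {N - r..<N}"
  interpret quadratic_irrational "(Theta :: 'p mod_ring fls) * \<tau> ^ ?k" "1 + \<tau>\<^sup>2"
    by (rule quadratic_irrational_Theta)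
  have "card ?R \<le> card {0, 1 :: nat} + card {N - r..<N}" by (rule card_Un_le)
  hence "card ?R \<le> r + 2" using r by simp
  hence "real n * real (card ?R) / real N \<le> real n * real (r + 2) / real N"
    by (intro divide_right_mono mult_left_mono) auto
  moreover have "escape (Theta :: 'p mod_ring fls) ?k n \<ge> 1 - real n * real (card ?R) / real N"
    using r by (intro escape_ge[OF refl] den_deg_Theta_residue[OF N r]) auto
  ultimately show ?thesis by linarith
qed

text \<open>Outside the bad set \<open>r + 2 <= 3 * q ^ j\<close> while
  \<open>N = q * q ^ j\<close>, so the loss is at most \<open>3 * n / q\<close>.\<close>

lemma escape_Theta_gt_of_not_bad:
  assumes q: "q = CARD('p) ^ L" "q \<ge> 3" and \<epsilon>: "3 * real n < \<epsilon> * real q"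
    and k: "k \<notin> bad_set q J"
  shows "escape (Theta :: 'p mod_ring fls) k n > 1 - \<epsilon>"
proof -
  obtain j where j: "k mod (2 * q ^ Suc j) \<in> {q ^ Suc j..<q ^ Suc j + 2 * q ^ j}"
    using k by (auto simp: bad_set_def)
  define N where "N = q ^ Suc j"
  define r where "r = k mod (2 * N) - N"
  define b where "b = k div (2 * N)"
  have "k = 2 * N * b + k mod (2 * N)" by (simp add: b_def)
  hence k_eq: "k = N * Suc (2 * b) + r"
    using j by (simp add: r_def N_def[symmetric] algebra_simps del: power_Suc)
  have r: "r < 2 * q ^ j" using j by (auto simp: r_def N_def)
  have qj: "q ^ j > 0" using q by simp
  have N: "N = q * q ^ j" by (simp add: N_def)
  have "2 * q ^ j \<le> N" unfolding N using q by (intro mult_right_mono) auto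
  hence "r < N" using r by linarith
  moreover have "N = CARD('p) ^ (L * Suc j)" by (simp only: N_def q(1) power_mult)
  ultimately have "escape (Theta :: 'p mod_ring fls) k n \<ge> 1 - real n * real (r + 2) / real N"
    unfolding k_eq by (intro escape_Theta_ge)
  moreover have "real n * real (r + 2) / real N < \<epsilon>"
  proof -
    have "r + 2 \<le> 3 * q ^ j" using r qj by linarith
    hence "real n * real (r + 2) \<le> real n * real (3 * q ^ j)"
      by (intro mult_left_mono) (simp_all only: of_nat_le_iff of_nat_0_le_iff)
    also have "\<dots> = 3 * real n * real (q ^ j)" by simp
    also have "\<dots> < \<epsilon> * real q * real (q ^ j)"
      using \<epsilon> qj by (intro mult_strict_right_mono) (simp_all only: of_nat_0_less_iff)
    also have "\<dots> = \<epsilon> * real N" by (simp add: N)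
    finally show ?thesis using qj q by (simp add: N pos_divide_less_eq)
  qed
  ultimately show ?thesis by linarith
qed

lemma nat_density_escape_Theta:
  assumes "\<epsilon> > 0"
  shows "nat_density {k. escape (Theta :: 'p mod_ring fls) k n > 1 - \<epsilon>} = 1"
proof -
  have p: "CARD('p) \<ge> 3"
    using CARD_gt_1[OF odd_p] odd_p by (cases "CARD('p) = 2") auto
  obtain L where L: "3 * real n / \<epsilon> < real CARD('p) ^ L"
    using real_arch_pow[of "real CARD('p)" "3 * real n / \<epsilon>"] p by auto
  \<comment> \<open>The exponent \<open>Suc L\<close> ensures \<open>q >= 3\<close> even for
    \<open>L = 0\<close>.\<close>
  define q where "q = CARD('p) ^ Suc L"
  have "CARD('p) ^ 1 \<le> q" unfolding q_def using p by (intro power_increasing) auto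
  hence q3: "q \<ge> 3" using p by simp
  have "real CARD('p) ^ L \<le> real q"
    unfolding q_def of_nat_power using p by (intro power_increasing) auto
  hence "3 * real n / \<epsilon> < real q" using L by linarith
  hence \<epsilon>: "3 * real n < \<epsilon> * real q" using assms by (simp add: pos_divide_less_eq mult.commute)
  show ?thesis
  proof (rule nat_density_eq_1)
    show "odd q" using odd_p by (simp add: q_def)
    show "q > 1" using q3 by simp
    show "- {k. escape (Theta :: 'p mod_ring fls) k n > 1 - \<epsilon>} \<subseteq> bad_set q J" for J
      using escape_Theta_gt_of_not_bad[OF q_def q3 \<epsilon>] by auto
  qed
qed

end

theorem theorem1p30:
  assumes "odd CARD('p::prime_card)"
  shows "\<forall>\<epsilon>::real. \<epsilon> > 0 \<longrightarrow>
    (\<lambda>n. nat_density {k. escape (Theta :: 'p mod_ring fls) k n > 1 - \<epsilon>}) \<longlonglongrightarrow> 1"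
  using nat_density_escape_Theta[OF assms] by simp

end
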